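(* Let $f_{i-2},f_{i-1},f_i,f_{i+1},f_{i+2}$ be real numbers whose smoothness indicators satisfy $\beta_0,\beta_1,\beta_2>0$. For $p>0$ let $\omega^{\mathrm{ZR}}_k(p)$, $k=0,1,2$, be the associated nonlinear weights with $\epsilon=0$. Then $$\lim_{p\to\infty}\omega^{\mathrm{ZR}}_k(p)=d_k,\qquad k=0,1,2,$$ and consequently the WENO numerical flux converges to the finite difference numerical flux: $$\lim_{p\to\infty}\sum_{k=0}^2\omega^{\mathrm{ZR}}_k(p)\,\hat f^{k}_{i+1/2}=\hat f^{\mathrm{FD}}_{i+1/2}.$$
   Context: Linear weights: $d_0=\frac1{10}$, $d_1=\frac35$, $d_2=\frac3{10}$. Smoothness indicators of the five values $f_{i-2},\dots,f_{i+2}$: $$\beta_0=\tfrac{13}{12}(f_{i-2}-2f_{i-1}+f_i)^2+\tfrac14(f_{i-2}-4f_{i-1}+3f_i)^2,$$ $$\beta_1=\tfrac{13}{12}(f_{i-1}-2f_i+f_{i+1})^2+\tfrac14(f_{i-1}-f_{i+1})^2,$$ $$\beta_2=\tfrac{13}{12}(f_i-2f_{i+1}+f_{i+2})^2+\tfrac14(3f_i-4f_{i+1}+f_{i+2})^2.$$ For $p>0$ (and $\epsilon=0$), the global smoothness indicator is $\tau^{\mathrm{ZR}}_5=\left|\beta_0^{1/p}-\beta_2^{1/p}\right|$, and the nonlinear weights are $$\omega^{\mathrm{ZR}}_k(p)=\frac{\alpha_k}{\sum_{s=0}^2\alpha_s},\qquad \alpha_k=d_k\left(1+\left(\frac{\tau^{\mathrm{ZR}}_5}{\beta_k^{1/p}}\right)^p\right),\qquad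 k=0,1,2.$$ Candidate numerical fluxes on the three substencils: $$\hat f^0_{i+1/2}=\tfrac13f_{i-2}-\tfrac76f_{i-1}+\tfrac{11}6f_i,\quad \hat f^1_{i+1/2}=-\tfrac16f_{i-1}+\tfrac56f_i+\tfrac13f_{i+1},\quad \hat f^2_{i+1/2}=\tfrac13f_i+\tfrac56f_{i+1}-\tfrac16f_{i+2}.$$ Finite difference numerical flux: $$\hat f^{\mathrm{FD}}_{i+1/2}=\tfrac1{30}f_{i-2}-\tfrac{13}{60}f_{i-1}+\tfrac{47}{60}f_i+\tfrac9{20}f_{i+1}-\tfrac1{20}f_{i+2}.$$ *)

theory Defs
  imports Complex_Main
begin

text \<open>
  The grid values are given by a function \<open>f\<close> on the integers, of which only the five values
  \<open>f (i - 2)\<close>, ..., \<open>f (i + 2)\<close> are used.  Substencils are numbered by \<open>k \<in> {0, 1, 2}\<close>;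
  the list lookups below are not meant to be used for other values of \<open>k\<close>.
\<close>

definition lin_weight :: "nat \<Rightarrow> real" where
  "lin_weight k = [1/10, 3/5, 3/10] ! k"

definition smoothness_ind :: "(int \<Rightarrow> real) \<Rightarrow> int \<Rightarrow> nat \<Rightarrow> real" where
  "smoothness_ind f i k =
     [13/12 * (f (i - 2) - 2 * f (i - 1) + f i)\<^sup>2 + 1/4 * (f (i - 2) - 4 * f (i - 1) + 3 * f i)\<^sup>2,
      13/12 * (f (i - 1) - 2 * f i + f (i + 1))\<^sup>2 + 1/4 * (f (i - 1) - f (i + 1))\<^sup>2,
      13/12 * (f i - 2 * f (i + 1) + f (i + 2))\<^sup>2 + 1/4 * (3 * f i - 4 * f (i + 1) + f (i + 2))\<^sup>2] ! k"

definition tau_ZR :: "(int \<Rightarrow> real) \<Rightarrow> int \<Rightarrow> real \<Rightarrow> real" where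
  "tau_ZR f i p = \<bar>smoothness_ind f i 0 powr (1/p) - smoothness_ind f i 2 powr (1/p)\<bar>"

text \<open>
  The quotient raised to the power \<open>p\<close> is nonnegative but may vanish; for \<open>p > 0\<close> the
  convention \<open>0 powr p = 0\<close> is the usual value of the power.
\<close>

definition alpha_ZR :: "(int \<Rightarrow> real) \<Rightarrow> int \<Rightarrow> real \<Rightarrow> nat \<Rightarrow> real" where
  "alpha_ZR f i p k =
     lin_weight k * (1 + (tau_ZR f i p / smoothness_ind f i k powr (1/p)) powr p)"

definition omega_ZR :: "(int \<Rightarrow> real) \<Rightarrow> int \<Rightarrow> real \<Rightarrow> nat \<Rightarrow> real" where
  "omega_ZR f i p k = alpha_ZR f i p k / (\<Sum>s=0..2. alpha_ZR f i p s)"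

definition candidate_flux :: "(int \<Rightarrow> real) \<Rightarrow> int \<Rightarrow> nat \<Rightarrow> real" where
  "candidate_flux f i k =
     [1/3 * f (i - 2) - 7/6 * f (i - 1) + 11/6 * f i,
      - 1/6 * f (i - 1) + 5/6 * f i + 1/3 * f (i + 1),
      1/3 * f i + 5/6 * f (i + 1) - 1/6 * f (i + 2)] ! k"

definition FD_flux :: "(int \<Rightarrow> real) \<Rightarrow> int \<Rightarrow> real" where
  "FD_flux f i =
     1/30 * f (i - 2) - 13/60 * f (i - 1) + 47/60 * f i + 9/20 * f (i + 1) - 1/20 * f (i + 2)"

end

theory Submission imports Defs begin

text \<open>
  For a positive constant \<open>a\<close> one has \<open>a powr (1/p) \<longlongrightarrow> 1\<close> as \<open>p\<close> grows, whatever \<open>a\<close> is. Hence the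
  global indicator, a difference of two such roots, tends to \<open>0\<close>, and so does its quotient by the
  root of any \<open>\<beta>\<^sub>k\<close>. Raising a quantity that tends to \<open>0\<close> to the growing power \<open>p\<close>
  only makes it smaller, so the unnormalised weights tend to the linear weights. These sum to \<open>1\<close>,
  and so the normalisation disappears in the limit. The statement on the fluxes follows because the
  combination of the candidate fluxes with the linear weights is the finite difference flux.
\<close>

lemma tendsto_powr_inverse_at_top:
  fixes a :: real
  assumes "a > 0"
  shows "((\<lambda>p. a powr (1/p)) \<longlongrightarrow> 1) at_top"
proof -
  have "((\<lambda>p::real. 1/p) \<longlongrightarrow> 0) at_top"
    using tendsto_inverse_0_at_top[OF filterlim_ident] by (simp add: inverse_eq_divide)
  then have "((\<lambda>p. a powr (1/p)) \<longlongrightarrow> a powr 0) at_top"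
    using assms by (intro tendsto_intros) auto
  then show ?thesis
    using assms by simp
qed

text \<open>
  The form \<open>0\<^sup>\<infinity>\<close> is not indeterminate: as soon as \<open>g p \<le> 1/2\<close>, the power is dominated by
  the exponential \<open>(1/2) powr p\<close>.
\<close>

lemma tendsto_zero_powr_at_top:
  fixes g :: "real \<Rightarrow> real"
  assumes lim: "(g \<longlongrightarrow> 0) at_top" and nonneg: "\<And>p. 0 \<le> g p"
  shows "((\<lambda>p. g p powr p) \<longlongrightarrow> 0) at_top"
proof (rule tendsto_sandwich)
  show "\<forall>\<^sub>F p in at_top. 0 \<le> g p powr p"
    by simp
  have "\<forall>\<^sub>F p in at_top. g p < 1/2"
    by (rule order_tendstoD(2)[OF lim]) simp
  then show "\<forall>\<^sub>F p in at_top. g p powr p \<le> (1/2) powr p"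
    using eventually_ge_at_top[of 0]
    by eventually_elim (auto intro!: powr_mono2 nonneg)
  have "filterlim (\<lambda>p::real. p * ln (1/2)) at_bot at_top"
    using filterlim_tendsto_neg_mult_at_bot[OF tendsto_const _ filterlim_ident, of "ln (1/2) :: real"]
    by (simp add: mult.commute)
  then show "((\<lambda>p::real. (1/2) powr p) \<longlongrightarrow> 0) at_top"
    by (auto simp: powr_def intro: filterlim_compose[OF exp_at_bot])
qed simp

lemma tendsto_alpha_ZR:
  assumes "smoothness_ind f i 0 > 0" and "smoothness_ind f i 2 > 0"
    and "smoothness_ind f i k > 0"
  shows "((\<lambda>p. alpha_ZR f i p k) \<longlongrightarrow> lin_weight k) at_top"
proof -
  have "((\<lambda>p. tau_ZR f i p / smoothness_ind f i k powr (1/p)) \<longlongrightarrow> \<bar>1 - 1\<bar> / 1) at_top"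
    unfolding tau_ZR_def using assms
    by (intro tendsto_intros tendsto_powr_inverse_at_top) auto
  then have "((\<lambda>p. (tau_ZR f i p / smoothness_ind f i k powr (1/p)) powr p) \<longlongrightarrow> 0) at_top"
    by (intro tendsto_zero_powr_at_top) (auto simp: tau_ZR_def)
  then have "((\<lambda>p. alpha_ZR f i p k) \<longlongrightarrow> lin_weight k * (1 + 0)) at_top"
    unfolding alpha_ZR_def by (intro tendsto_intros)
  then show ?thesis
    by simp
qed

lemma sum_lin_weight: "(\<Sum>k=0..2. lin_weight k) = 1"
  by (simp add: numeral_2_eq_2 lin_weight_def)

lemma sum_lin_weight_candidate_flux:
  "(\<Sum>k=0..2. lin_weight k * candidate_flux f i k) = FD_flux f i"
  by (simp add: numeral_2_eq_2 lin_weight_def candidate_flux_def FD_flux_def)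
     (simp add: field_simps)

theorem mainTheorem1:
  fixes f :: "int \<Rightarrow> real" and i :: int
  assumes "smoothness_ind f i 0 > 0"
    and "smoothness_ind f i 1 > 0"
    and "smoothness_ind f i 2 > 0"
  shows "(\<forall>k\<in>{0, 1, 2}. ((\<lambda>p::real. omega_ZR f i p k) \<longlongrightarrow> lin_weight k) at_top) \<and>
    ((\<lambda>p::real. \<Sum>k=0..2. omega_ZR f i p k * candidate_flux f i k) \<longlongrightarrow> FD_flux f i) at_top"
proof -
  have indices: "{0..2} = {0, 1, 2::nat}"
    by auto
  have alpha: "((\<lambda>p. alpha_ZR f i p k) \<longlongrightarrow> lin_weight k) at_top" if "k \<in> {0..2}" for k
    using that assms unfolding indices by (intro tendsto_alpha_ZR) auto
  have omega: "((\<lambda>p. omega_ZR f i p k) \<longlongrightarrow> lin_weight k) at_top" if "k \<in> {0..2}" for k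
  proof -
    have "((\<lambda>p. \<Sum>s=0..2. alpha_ZR f i p s) \<longlongrightarrow> 1) at_top"
      unfolding sum_lin_weight[symmetric] by (intro tendsto_sum alpha)
    then have "((\<lambda>p. omega_ZR f i p k) \<longlongrightarrow> lin_weight k / 1) at_top"
      unfolding omega_ZR_def using alpha[OF that] by (intro tendsto_divide) auto
    then show ?thesis
      by simp
  qed
  have "((\<lambda>p. \<Sum>k=0..2. omega_ZR f i p k * candidate_flux f i k) \<longlongrightarrow>
      (\<Sum>k=0..2. lin_weight k * candidate_flux f i k)) at_top"
    by (intro tendsto_sum tendsto_mult omega tendsto_const)
  then show ?thesis
    using omega unfolding indices[symmetric] sum_lin_weight_candidate_flux by blast
qed

end
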